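(* Let $\Omega=(-B,B)^d\subset\mathbb{R}^d$ with $B>0$, and fix $\gamma\in(0,1)$. Let $\mathbf{x}_1,\mathbf{x}_2,\ldots$ be a sequence of points in $\Omega$ and write $\mathbf{X}_N=\{\mathbf{x}_1,\ldots,\mathbf{x}_N\}$. Define the fill distance and the separation distance $$h_N:=\sup_{\mathbf{x}\in\Omega}\min_{1\le i\le N}\|\mathbf{x}-\mathbf{x}_i\|_2,\qquad q_N:=\frac12\min_{1\le i\ne j\le N}\|\mathbf{x}_i-\mathbf{x}_j\|_2 .$$ Suppose that for every $N\ge1$ the point $\mathbf{x}_{N+1}$ is selected from $$\Omega_\gamma=\Omega\cap\left\{\mathbf{t}:\ \min_{1\le i\le N}\|\mathbf{t}-\mathbf{x}_i\|_2\ge\gamma h_N\right\}$$ (which depends on $\mathbf{X}_N$). Then for any $N\ge2$, $$\frac{h_N}{q_N}\le2\gamma^{-1}.$$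
   Context: $\|\cdot\|_2$ is the Euclidean norm on $\mathbb{R}^d$. All notions are defined in the statement. *)

theory Defs
  imports "HOL-Analysis.Analysis"
begin

definition cube :: "real \<Rightarrow> (real ^ 'd) set" where
  "cube B = {t. \<forall>i. - B < t $ i \<and> t $ i < B}"

text \<open>The points are \<open>x 1, x 2, \<dots>\<close>; the value \<open>x 0\<close> is never used.
  The minima are over nonempty finite sets for \<open>N \<ge> 1\<close> in \<open>fill_distance\<close> and
  \<open>admissible\<close>, and for \<open>N \<ge> 2\<close> in \<open>separation_distance\<close>. The supremum is a genuine
  one whenever \<open>\<Omega>\<close> is nonempty and bounded.\<close>

definition fill_distance :: "(real ^ 'd) set \<Rightarrow> (nat \<Rightarrow> real ^ 'd) \<Rightarrow> nat \<Rightarrow> real" where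
  "fill_distance \<Omega> x N = (SUP t\<in>\<Omega>. MIN i\<in>{1..N}. norm (t - x i))"

definition separation_distance :: "(nat \<Rightarrow> real ^ 'd) \<Rightarrow> nat \<Rightarrow> real" where
  "separation_distance x N =
     1 / 2 * Min {norm (x i - x j) | i j. i \<in> {1..N} \<and> j \<in> {1..N} \<and> i \<noteq> j}"

definition admissible ::
  "(real ^ 'd) set \<Rightarrow> real \<Rightarrow> (nat \<Rightarrow> real ^ 'd) \<Rightarrow> nat \<Rightarrow> (real ^ 'd) set" where
  "admissible \<Omega> \<gamma> x N =
     \<Omega> \<inter> {t. (MIN i\<in>{1..N}. norm (t - x i)) \<ge> \<gamma> * fill_distance \<Omega> x N}"

end

theory Submission
  imports Defs
begin

text \<open>
  When a point \<open>x j\<close> is chosen, the selection rule keeps it at distance at least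
  \<open>\<gamma> h\<close> from all earlier points, where \<open>h\<close> is the fill distance at that moment.
  Adding points only decreases the fill distance
  (\<open>fill_distance_antimono\<close>), so the fill distance \<open>h\<^sub>N\<close> at the end is at most \<open>h\<close>,
  and \<open>\<gamma> h\<^sub>N\<close> is a lower bound for all pairwise distances
  at once (\<open>greedy_points_separated\<close>). Hence the separation distance is at least
  \<open>\<gamma> h\<^sub>N / 2\<close>, which is the claimed bound on the ratio. The separation distance is positive
  because \<open>h\<^sub>N\<close> is: a nonempty open set is not exhausted by finitely many points
  (\<open>fill_distance_pos\<close>).
\<close>

lemma cube_eq_box: "cube B = box (\<chi> i. - B) (\<chi> i. B)"
  by (auto simp: cube_def mem_box_cart)

lemma cube_nonempty: "B > 0 \<Longrightarrow> cube B \<noteq> {}"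
  by (auto simp: cube_def intro!: exI[of _ 0])

text \<open>The fill distance is a supremum of reals, so comparing it with the individual
  distances requires them to be bounded; the distance to \<open>x 1\<close> alone bounds them.\<close>

lemma bdd_above_min_distance:
  fixes x :: "nat \<Rightarrow> real ^ 'd"
  assumes "bounded \<Omega>" "N \<ge> 1"
  shows "bdd_above ((\<lambda>t. MIN i\<in>{1..N}. norm (t - x i)) ` \<Omega>)"
proof -
  obtain C where C: "\<And>t. t \<in> \<Omega> \<Longrightarrow> norm t \<le> C"
    using assms(1) by (auto simp: bounded_iff)
  have "(MIN i\<in>{1..N}. norm (t - x i)) \<le> C + norm (x 1)" if "t \<in> \<Omega>" for t
  proof -
    have "(MIN i\<in>{1..N}. norm (t - x i)) \<le> norm (t - x 1)"
      using assms(2) by (intro Min_le) auto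
    also have "\<dots> \<le> norm t + norm (x 1)"
      by (rule norm_triangle_ineq4)
    finally show ?thesis
      using C[OF that] by linarith
  qed
  then show ?thesis
    by (auto intro!: bdd_aboveI2)
qed

lemma fill_distance_antimono:
  fixes x :: "nat \<Rightarrow> real ^ 'd"
  assumes "bounded \<Omega>" "\<Omega> \<noteq> {}" "1 \<le> m" "m \<le> n"
  shows "fill_distance \<Omega> x n \<le> fill_distance \<Omega> x m"
  unfolding fill_distance_def
proof (rule cSUP_mono)
  show "\<exists>s\<in>\<Omega>. (MIN i\<in>{1..n}. norm (t - x i)) \<le> (MIN i\<in>{1..m}. norm (s - x i))"
    if "t \<in> \<Omega>" for t
    using that assms(3,4) by (intro bexI[of _ t] Min_antimono image_mono) auto
qed (use assms bdd_above_min_distance[of \<Omega> m x] in auto)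

lemma fill_distance_pos:
  fixes x :: "nat \<Rightarrow> real ^ 'd"
  assumes "bounded \<Omega>" "open \<Omega>" "\<Omega> \<noteq> {}" "N \<ge> 1"
  shows "fill_distance \<Omega> x N > 0"
proof -
  have "infinite \<Omega>"
    using assms(2,3) finite_imp_not_open by blast
  then have "\<not> \<Omega> \<subseteq> x ` {1..N}"
    using finite_subset by blast
  then obtain t where t: "t \<in> \<Omega>" "t \<notin> x ` {1..N}"
    by blast
  then have "0 < (MIN i\<in>{1..N}. norm (t - x i))"
    using assms(4) by (subst Min_gr_iff) auto
  also have "\<dots> \<le> fill_distance \<Omega> x N"
    unfolding fill_distance_def
    using t(1) bdd_above_min_distance[OF assms(1,4)] by (rule cSUP_upper)
  finally show ?thesis .
qed

lemma greedy_points_separated: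
  fixes x :: "nat \<Rightarrow> real ^ 'd"
  assumes "bounded \<Omega>" "\<Omega> \<noteq> {}" "\<gamma> \<ge> 0"
    and greedy: "\<And>n. n \<ge> 1 \<Longrightarrow> x (n + 1) \<in> admissible \<Omega> \<gamma> x n"
    and "i \<in> {1..N}" "j \<in> {1..N}" "i \<noteq> j"
  shows "\<gamma> * fill_distance \<Omega> x N \<le> norm (x i - x j)"
  using assms(5-7)
proof (induction i j rule: linorder_wlog)
  case (le i j)
  \<comment> \<open>The later point \<open>x j\<close> was selected when exactly \<open>m = j - 1\<close> points were present.\<close>
  then obtain m where j: "j = m + 1" and m: "i \<le> m" "1 \<le> m" "m \<le> N"
    by (cases j) auto
  have "\<gamma> * fill_distance \<Omega> x N \<le> \<gamma> * fill_distance \<Omega> x m"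
    using assms(1-3) m by (intro mult_left_mono fill_distance_antimono)
  also have "\<dots> \<le> (MIN k\<in>{1..m}. norm (x j - x k))"
    using greedy[OF m(2)] by (simp add: admissible_def j)
  also have "\<dots> \<le> norm (x j - x i)"
    using le m by (intro Min_le) auto
  finally show ?case
    by (simp add: norm_minus_commute)
next
  case (sym i j)
  then show ?case
    by (simp add: norm_minus_commute)
qed

lemma separation_distance_ge:
  fixes x :: "nat \<Rightarrow> real ^ 'd"
  assumes "N \<ge> 2"
    and "\<And>i j. \<lbrakk>i \<in> {1..N}; j \<in> {1..N}; i \<noteq> j\<rbrakk> \<Longrightarrow> c \<le> norm (x i - x j)"
  shows "c / 2 \<le> separation_distance x N"
proof -
  let ?D = "{norm (x i - x j) | i j. i \<in> {1..N} \<and> j \<in> {1..N} \<and> i \<noteq> j}"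
  have "?D \<subseteq> (\<lambda>(i, j). norm (x i - x j)) ` ({1..N} \<times> {1..N})"
    by auto
  then have "finite ?D"
    by (rule finite_subset) simp
  moreover have "norm (x 1 - x 2) \<in> ?D"
    using assms(1) by force
  ultimately have "c \<le> Min ?D"
    using assms(2) by (subst Min_ge_iff) blast+
  then show ?thesis
    by (simp add: separation_distance_def)
qed

theorem theorem3:
  fixes B \<gamma> :: real and x :: "nat \<Rightarrow> real ^ 'd" and N :: nat
  assumes "B > 0" and "0 < \<gamma>" and "\<gamma> < 1"
    and "\<And>n. n \<ge> 1 \<Longrightarrow> x n \<in> cube B"
    and "\<And>n. n \<ge> 1 \<Longrightarrow> x (n + 1) \<in> admissible (cube B) \<gamma> x n"
    and "N \<ge> 2"
  shows "separation_distance x N > 0 \<and>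
         fill_distance (cube B) x N / separation_distance x N \<le> 2 * inverse \<gamma>"
proof -
  let ?h = "fill_distance (cube B) x N" and ?q = "separation_distance x N"
  have cube: "bounded (cube B :: (real ^ 'd) set)" "open (cube B :: (real ^ 'd) set)"
    "(cube B :: (real ^ 'd) set) \<noteq> {}"
    using cube_nonempty[OF assms(1)] by (auto simp: cube_eq_box open_box)
  have h: "?h > 0"
    using cube assms(6) by (intro fill_distance_pos) auto
  have q: "\<gamma> * ?h / 2 \<le> ?q"
    using cube assms(2,5,6)
    by (intro separation_distance_ge greedy_points_separated) auto
  have "0 < \<gamma> * ?h / 2"
    using assms(2) h by simp
  with q have "?q > 0"
    by linarith
  with q assms(2) show ?thesis
    by (simp add: field_simps)
qed

end
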